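(* Let $\mathfrak{s}=\mathfrak{s}(\mathfrak{g},\mathfrak{a})$ be a souped-up Lie algebra, let $N(s,t)\ge0$ be a function on $\mathfrak{s}\times\mathfrak{s}$, let $I(\mathfrak{s})$ be the corresponding souped-up vertex algebra ideal, and suppose $I(\mathfrak{s})\cap\mathfrak{s}=\{0\}$. Then for any pair of elements $a\in\mathfrak{a}$ and $g\in\mathfrak{g}$ satisfying $[g,a]=\mathbf{1}$, the locality generators $\{s_nt : s,t\in\mathfrak{s},\ n\ge N(s,t)\}$ must omit $a_ng$ for at least two positive values of $n$. In particular, if $N$ is a constant such that $I(\mathfrak{s})\cap\mathfrak{s}=\{0\}$ for every souped-up Lie algebra $\mathfrak{s}$ when $I(\mathfrak{s})$ is formed with $N(s,t)\equiv N$, then $N\ge 3$.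
   Context: Conventions. Vector spaces are over a field of characteristic $0$ and are $\mathbf{Z}/2$-graded, with parity $p$; "commutative", "Lie algebra", etc. are meant in the super sense. For a vector space $\mathfrak{v}$ with a distinguished even nonzero vector $\mathbf{1}$, $F(\mathfrak{v})$ is the free nonassociative algebra on the vector space $\mathfrak{v}$ with bilinear products $x\circ_n y=x_ny$, $n\in\mathbf{Z}$ (no relations other than bilinearity; $p(x_ny)=p(x)+p(y)$); $\mathfrak{v}\subset F(\mathfrak{v})$. A monomial is an iterated product of elements of $\mathfrak{v}$. Ideals are closed under left and right multiplication by all elements for all $\circ_n$. Put $Dx=x_{-2}\mathbf{1}$. Vertex algebra ideal. Given $N(u,v)\ge 0$ on $\mathfrak{v}\times\mathfrak{v}$, $I(\mathfrak{v})$ is the ideal of $F(\mathfrak{v})$ generated, for $u,v\in\mathfrak{v}$ and (parity-homogeneous) $x,y,z\in F(\mathfrak{v})$, by - $\mathbf{1}_nx-\delta_{n,-1}x$; - (locality) $u_nv$ for all $n\ge N(u,v)$; - $D(x_ny)-(Dx)_ny-x_n(Dy)$; - $(Dx)_ny+n\,x_{n-1}y$ for all $n\in\mathbf{Z}$; - $x_ny+(-1)^{p(x)p(y)}\sum_{k\ge0}\frac{(-1)^{n+k}}{k!}D^k(y_{n+k}x)$; - $(x_my)_nz-\sum_{k\ge0}\binom{m}{k}(-1)^k\big(x_{m-k}(y_{n+k}z)-(-1)^{m+p(x)p(y)}y_{m+n-k}(x_kz)\big)$; where, unless indicated otherwise, each of $m,n$ ranges over $-1$ and all sufficiently large integers (threshold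 independent of $x,y,z$). The infinite sums are read modulo the ideal: for each $x,y$ one has $x_ny\in I(\mathfrak{v})$ for all large $n$, and terms lying in the ideal for this reason are dropped, so that each sum is finite. Souped-up Lie algebra $\mathfrak{s}=\mathfrak{s}(\mathfrak{g},\mathfrak{a})$: $\mathfrak{a}$ is an associative commutative unital algebra ($\mathbf{1}\ne0$), $\mathfrak{g}$ a Lie algebra which is a left $\mathfrak{a}$-module, $\mathfrak{a}$ is a $\mathfrak{g}$-module on which $\mathfrak{g}$ acts by derivations, written $[g,a]=-[a,g]$ (up to super signs), and $[g,ah]=[g,a]h+a[g,h]$. $\mathfrak{s}$ is the semidirect sum Lie algebra $\mathfrak{g}\oplus\mathfrak{a}$ ($\mathfrak{a}$ abelian) together with left multiplication by $\mathfrak{a}$; its distinguished vector is $\mathbf{1}\in\mathfrak{a}$. The souped-up vertex algebra ideal $I(\mathfrak{s})\subset F(\mathfrak{s})$ is generated by the generators above (for the unital vector space underlying $\mathfrak{s}$, with the function $N(s,t)$ on $\mathfrak{s}\times\mathfrak{s}$) and by $s_0t-[s,t]$, $a_{-1}s-as$, $(ab)_{-1}x-a_{-1}(b_{-1}x)$ for $a,b\in\mathfrak{a}$, $s,t\in\mathfrak{s}$, monomials $x\in F(\mathfrak{s})$.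
   Formalization: The element a is assumed to be even; for odd a the claim fails (a=k[ξ] with ξ odd, g=k[ξ]d/dξ, realized in the bc system, with N=2 except N(ξ,d/dξ)=1, omits no positive n). *)

theory Defs
  imports "HOL-Library.Poly_Mapping" "HOL-Library.Z2" "HOL-Library.Product_Plus"
    "HOL-Computational_Algebra.Polynomial"
begin

section \<open>Super vector spaces\<close>

text \<open>
  Parities are elements of the two-element field \<^typ>\<open>bit\<close>; \<^term>\<open>part i\<close> is the homogeneous
  part of parity \<open>i\<close>.
\<close>

definition super_vector_space ::
    "('k::field \<Rightarrow> 'v::ab_group_add \<Rightarrow> 'v) \<Rightarrow> (bit \<Rightarrow> 'v set) \<Rightarrow> bool" where
  "super_vector_space scale part \<longleftrightarrow>
     vector_space scale \<and>
     (\<forall>i. module.subspace scale (part i)) \<and>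
     (\<forall>x. \<exists>!y. y \<in> part 0 \<and> x - y \<in> part 1)"

definition component :: "(bit \<Rightarrow> 'v::ab_group_add set) \<Rightarrow> bit \<Rightarrow> 'v \<Rightarrow> 'v" where
  "component part i x = (THE y. y \<in> part i \<and> x - y \<in> part (i + 1))"

definition super_sign :: "bit \<Rightarrow> bit \<Rightarrow> 'k::ring_1" where
  "super_sign i j = (if i = 1 \<and> j = 1 then - 1 else 1)"

definition even_bilinear ::
    "('k::field \<Rightarrow> 'u::ab_group_add \<Rightarrow> 'u) \<Rightarrow> (bit \<Rightarrow> 'u set) \<Rightarrow>
     ('k \<Rightarrow> 'v::ab_group_add \<Rightarrow> 'v) \<Rightarrow> (bit \<Rightarrow> 'v set) \<Rightarrow>
     ('k \<Rightarrow> 'w::ab_group_add \<Rightarrow> 'w) \<Rightarrow> (bit \<Rightarrow> 'w set) \<Rightarrow> ('u \<Rightarrow> 'v \<Rightarrow> 'w) \<Rightarrow> bool" where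
  "even_bilinear sU pU sV pV sW pW f \<longleftrightarrow>
     (\<forall>x. Vector_Spaces.linear sV sW (f x)) \<and> (\<forall>y. Vector_Spaces.linear sU sW (\<lambda>x. f x y)) \<and>
     (\<forall>i j. \<forall>x\<in>pU i. \<forall>y\<in>pV j. f x y \<in> pW (i + j))"

record ('k, 'v) unital_space =
  scal :: "'k \<Rightarrow> 'v \<Rightarrow> 'v"
  part :: "bit \<Rightarrow> 'v set"
  vac :: 'v


section \<open>The free nonassociative algebra\<close>

text \<open>
  The free nonassociative algebra \<open>F(V)\<close> with products \<open>\<circ>\<^sub>n\<close> (\<open>n \<in> \<int>\<close>) on a vector space \<open>V\<close>
  is realized as the vector space whose basis consists of the bracketed words in a fixed basis of
  \<open>V\<close>; \<open>gen\<close> is the inclusion of \<open>V\<close>.  The universal property is proved below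
  (\<open>free_algebra_universal\<close>, \<open>free_algebra_unique\<close>).
\<close>

datatype 'v word = Leaf 'v | Node int "'v word" "'v word"

type_synonym ('k, 'v) expr = "'v word \<Rightarrow>\<^sub>0 'k"

definition basis_of :: "('k::field, 'v::ab_group_add) unital_space \<Rightarrow> 'v set" where
  "basis_of V = vector_space.extend_basis (scal V) {}"

definition free_algebra ::
    "('k::field, 'v::ab_group_add) unital_space \<Rightarrow> ('k, 'v) expr set" where
  "free_algebra V = {p. \<forall>t\<in>Poly_Mapping.keys p. set_word t \<subseteq> basis_of V}"

definition fscale :: "'k::field \<Rightarrow> ('k, 'v) expr \<Rightarrow> ('k, 'v) expr" where
  "fscale c p = Poly_Mapping.map ((*) c) p"

definition fprod :: "int \<Rightarrow> ('k::field, 'v) expr \<Rightarrow> ('k, 'v) expr \<Rightarrow> ('k, 'v) expr" where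
  "fprod n p q =
     (\<Sum>s\<in>Poly_Mapping.keys p. \<Sum>t\<in>Poly_Mapping.keys q.
        Poly_Mapping.single (Node n s t) (Poly_Mapping.lookup p s * Poly_Mapping.lookup q t))"

definition gen :: "('k::field, 'v::ab_group_add) unital_space \<Rightarrow> 'v \<Rightarrow> ('k, 'v) expr" where
  "gen V v =
     (\<Sum>b | module.representation (scal V) (basis_of V) v b \<noteq> 0.
        Poly_Mapping.single (Leaf b) (module.representation (scal V) (basis_of V) v b))"

subsection \<open>The universal property\<close>

lemma lookup_fscale [simp]: "Poly_Mapping.lookup (fscale c p) t = c * Poly_Mapping.lookup p t"
  by (simp add: fscale_def Poly_Mapping.map.rep_eq when_def)

lemma lookup_fprod_Node [simp]:
  "Poly_Mapping.lookup (fprod n p q) (Node m s t) =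
     (if m = n then Poly_Mapping.lookup p s * Poly_Mapping.lookup q t else 0)"
proof -
  have "Poly_Mapping.lookup (fprod n p q) (Node m s t) =
      (\<Sum>s'\<in>Poly_Mapping.keys p. \<Sum>t'\<in>Poly_Mapping.keys q.
         if s' = s \<and> t' = t \<and> m = n
         then Poly_Mapping.lookup p s * Poly_Mapping.lookup q t else 0)"
    unfolding fprod_def lookup_sum
    by (intro sum.cong refl) (auto simp: lookup_single when_def)
  also have "\<dots> = (\<Sum>s'\<in>Poly_Mapping.keys p. if s' = s then
      (\<Sum>t'\<in>Poly_Mapping.keys q. if t' = t then
         if m = n then Poly_Mapping.lookup p s * Poly_Mapping.lookup q t else 0 else 0) else 0)"
    by (intro sum.cong refl) auto
  also have "\<dots> = (if m = n then Poly_Mapping.lookup p s * Poly_Mapping.lookup q t else 0)"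
    by (auto simp: in_keys_iff)
  finally show ?thesis .
qed

lemma lookup_fprod_Leaf [simp]: "Poly_Mapping.lookup (fprod n p q) (Leaf v) = 0"
  by (simp add: fprod_def lookup_sum lookup_single)

lemma vector_space_fscale: "vector_space (fscale :: 'k::field \<Rightarrow> ('k, 'v) expr \<Rightarrow> ('k, 'v) expr)"
  by unfold_locales (auto intro!: poly_mapping_eqI simp: lookup_add algebra_simps)

lemma linear_fprod_right:
  "Vector_Spaces.linear fscale fscale (fprod n (p :: ('k::field, 'v) expr))"
proof -
  have "fprod n p (x + y) = fprod n p x + fprod n p y"
    "fprod n p (fscale c x) = fscale c (fprod n p x)" for c x y
    by (rule poly_mapping_eqI; rename_tac t; case_tac t; simp add: lookup_add algebra_simps)+
  then show ?thesis
    by (simp add: Vector_Spaces.linear_iff vector_space_fscale)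
qed

lemma linear_fprod_left:
  "Vector_Spaces.linear fscale fscale (\<lambda>p. fprod n p (q :: ('k::field, 'v) expr))"
proof -
  have "fprod n (x + y) q = fprod n x q + fprod n y q"
    "fprod n (fscale c x) q = fscale c (fprod n x q)" for c x y
    by (rule poly_mapping_eqI; rename_tac t; case_tac t; simp add: lookup_add algebra_simps)+
  then show ?thesis
    by (simp add: Vector_Spaces.linear_iff vector_space_fscale)
qed

lemma basis_of:
  assumes "vector_space (scal V)"
  shows "module.independent (scal V) (basis_of V)" "module.span (scal V) (basis_of V) = UNIV"
proof -
  interpret vector_space "scal V" by (fact assms)
  show "independent (basis_of V)" "span (basis_of V) = UNIV"
    by (simp_all add: basis_of_def independent_extend_basis independent_empty)
qed

lemma lookup_gen [simp]:
  assumes "vector_space (scal V)"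
  shows "Poly_Mapping.lookup (gen V v) (Leaf b) = module.representation (scal V) (basis_of V) v b"
    "Poly_Mapping.lookup (gen V v) (Node n s t) = 0"
proof -
  interpret vector_space "scal V" by (fact assms)
  have "Poly_Mapping.lookup (gen V v) (Leaf b) =
      (\<Sum>b' | representation (basis_of V) v b' \<noteq> 0.
        if b' = b then representation (basis_of V) v b else 0)"
    unfolding gen_def lookup_sum by (intro sum.cong) (auto simp: lookup_single when_def)
  then show "Poly_Mapping.lookup (gen V v) (Leaf b) = representation (basis_of V) v b"
    by (simp add: finite_representation)
  show "Poly_Mapping.lookup (gen V v) (Node n s t) = 0"
    by (simp add: gen_def lookup_sum lookup_single)
qed

lemma linear_gen:
  assumes "vector_space (scal V)"
  shows "Vector_Spaces.linear (scal V) fscale (gen V)"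
proof -
  interpret vector_space "scal V" by (fact assms)
  have "gen V (x + y) = gen V x + gen V y" "gen V (scal V c x) = fscale c (gen V x)" for c x y
    by (rule poly_mapping_eqI; rename_tac t; case_tac t;
        simp add: assms lookup_add basis_of representation_add representation_scale)+
  then show ?thesis
    by (simp add: Vector_Spaces.linear_iff vector_space_fscale assms)
qed

lemma inj_gen:
  assumes "vector_space (scal V)"
  shows "inj (gen V)"
proof (rule injI)
  interpret vector_space "scal V" by (fact assms)
  fix x y assume "gen V x = gen V y"
  then have eq: "representation (basis_of V) x = representation (basis_of V) y"
    using lookup_gen(1)[OF assms] by (intro ext) metis
  have sum: "(\<Sum>b | representation (basis_of V) v b \<noteq> 0. scal V (representation (basis_of V) v b) b) = v"
    for v
    by (rule sum_nonzero_representation_eq) (use basis_of[OF assms] in blast)+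
  show "x = y"
    using sum[of x] unfolding eq sum by (rule sym)
qed

lemma gen_in_free_algebra:
  assumes "vector_space (scal V)"
  shows "gen V v \<in> free_algebra V"
proof -
  interpret vector_space "scal V" by (fact assms)
  have "set_word t \<subseteq> basis_of V" if "t \<in> Poly_Mapping.keys (gen V v)" for t
    using that by (cases t) (auto simp: assms in_keys_iff dest: representation_ne_zero)
  then show ?thesis by (auto simp: free_algebra_def)
qed

lemma free_algebra_closed:
  "0 \<in> free_algebra V"
  "x \<in> free_algebra V \<Longrightarrow> y \<in> free_algebra V \<Longrightarrow> x + y \<in> free_algebra V"
  "x \<in> free_algebra V \<Longrightarrow> fscale c x \<in> free_algebra V"
  "x \<in> free_algebra V \<Longrightarrow> y \<in> free_algebra V \<Longrightarrow> fprod n x y \<in> free_algebra V"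
proof -
  show "0 \<in> free_algebra V" by (simp add: free_algebra_def)
  show "x \<in> free_algebra V \<Longrightarrow> y \<in> free_algebra V \<Longrightarrow> x + y \<in> free_algebra V"
    using keys_add[of x y] by (auto simp: free_algebra_def)
  show "x \<in> free_algebra V \<Longrightarrow> fscale c x \<in> free_algebra V"
    by (auto simp: free_algebra_def in_keys_iff)
  assume *: "x \<in> free_algebra V" "y \<in> free_algebra V"
  have "set_word t \<subseteq> basis_of V" if "t \<in> Poly_Mapping.keys (fprod n x y)" for t
  proof (cases t)
    case (Node m s u)
    then have "s \<in> Poly_Mapping.keys x" "u \<in> Poly_Mapping.keys y"
      using that by (auto simp: in_keys_iff split: if_splits)
    then have "set_word s \<subseteq> basis_of V" "set_word u \<subseteq> basis_of V"
      using * by (auto simp: free_algebra_def)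
    then show ?thesis using Node by simp
  qed (use that in \<open>simp add: in_keys_iff\<close>)
  then show "fprod n x y \<in> free_algebra V"
    by (auto simp: free_algebra_def)
qed

primrec eval_word :: "(int \<Rightarrow> 't \<Rightarrow> 't \<Rightarrow> 't) \<Rightarrow> ('v \<Rightarrow> 't) \<Rightarrow> 'v word \<Rightarrow> 't" where
  "eval_word mu phi (Leaf v) = phi v"
| "eval_word mu phi (Node n s t) = mu n (eval_word mu phi s) (eval_word mu phi t)"

theorem free_algebra_universal:
  fixes V :: "('k::field, 'v::ab_group_add) unital_space"
    and sT :: "'k \<Rightarrow> 't::ab_group_add \<Rightarrow> 't" and mu :: "int \<Rightarrow> 't \<Rightarrow> 't \<Rightarrow> 't"
  assumes mu: "\<And>n x. Vector_Spaces.linear sT sT (mu n x)"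
      "\<And>n y. Vector_Spaces.linear sT sT (\<lambda>x. mu n x y)"
    and phi: "Vector_Spaces.linear (scal V) sT phi"
  shows "\<exists>h. Vector_Spaces.linear fscale sT h \<and>
           (\<forall>n x y. h (fprod n x y) = mu n (h x) (h y)) \<and> (\<forall>v. h (gen V v) = phi v)"
proof -
  interpret phi: Vector_Spaces.linear "scal V" sT phi by (fact phi)
  define ev where "ev = eval_word mu phi"
  define h where "h p = (\<Sum>t\<in>Poly_Mapping.keys p. sT (Poly_Mapping.lookup p t) (ev t))" for p
  have h_eq: "h p = (\<Sum>t\<in>A. sT (Poly_Mapping.lookup p t) (ev t))"
    if "finite A" "Poly_Mapping.keys p \<subseteq> A" for p A
    unfolding h_def
    by (rule sum.mono_neutral_left) (use that in \<open>auto simp: in_keys_iff\<close>)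
  have add: "h (p + q) = h p + h q" for p q
  proof -
    let ?A = "Poly_Mapping.keys p \<union> Poly_Mapping.keys q"
    have "h (p + q) = (\<Sum>t\<in>?A. sT (Poly_Mapping.lookup (p + q) t) (ev t))"
      by (rule h_eq) (auto dest: keys_add[THEN subsetD])
    also have "\<dots> = (\<Sum>t\<in>?A. sT (Poly_Mapping.lookup p t) (ev t))
        + (\<Sum>t\<in>?A. sT (Poly_Mapping.lookup q t) (ev t))"
      by (simp add: lookup_add phi.vs2.scale_left_distrib sum.distrib)
    also have "\<dots> = h p + h q"
      by (simp add: h_eq[of ?A p] h_eq[of ?A q])
    finally show ?thesis .
  qed
  have scale: "h (fscale c p) = sT c (h p)" for c p
  proof -
    have "h (fscale c p) = (\<Sum>t\<in>Poly_Mapping.keys p. sT (Poly_Mapping.lookup (fscale c p) t) (ev t))"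
      by (rule h_eq) (auto simp: in_keys_iff)
    then show ?thesis by (simp add: h_def phi.vs2.scale_sum_right)
  qed
  have prod: "h (fprod n p q) = mu n (h p) (h q)" for n p q
  proof -
    interpret l: Vector_Spaces.linear sT sT "\<lambda>x. mu n x y" for y by (rule mu)
    interpret r: Vector_Spaces.linear sT sT "mu n x" for x by (rule mu)
    let ?P = "Poly_Mapping.keys p \<times> Poly_Mapping.keys q"
    let ?f = "\<lambda>(s, t). Node n s t"
    have inj: "inj_on ?f ?P" by (auto simp: inj_on_def)
    have keys: "Poly_Mapping.keys (fprod n p q) \<subseteq> ?f ` ?P"
    proof
      fix w assume "w \<in> Poly_Mapping.keys (fprod n p q)"
      then show "w \<in> ?f ` ?P"
        by (cases w) (auto simp: in_keys_iff split: if_splits)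
    qed
    have "h (fprod n p q) = (\<Sum>w\<in>?f ` ?P. sT (Poly_Mapping.lookup (fprod n p q) w) (ev w))"
      by (rule h_eq[OF _ keys]) auto
    also have "\<dots> = (\<Sum>(s, t)\<in>?P. sT (Poly_Mapping.lookup p s)
        (sT (Poly_Mapping.lookup q t) (mu n (ev s) (ev t))))"
      by (subst sum.reindex[OF inj]) (simp add: case_prod_beta ev_def)
    also have "\<dots> = mu n (h p) (h q)"
      by (simp add: h_def l.sum r.sum l.scale r.scale sum.cartesian_product[symmetric]
          phi.vs2.scale_sum_right)
        (subst sum.swap, simp add: mult.commute)
    finally show ?thesis .
  qed
  have gen: "h (gen V v) = phi v" for v
  proof -
    let ?B = "{b. phi.vs1.representation (basis_of V) v b \<noteq> 0}"
    have V: "vector_space (scal V)" by unfold_locales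
    have keys: "Poly_Mapping.keys (gen V v) \<subseteq> Leaf ` ?B"
    proof
      fix w assume "w \<in> Poly_Mapping.keys (gen V v)"
      then show "w \<in> Leaf ` ?B" by (cases w) (auto simp: in_keys_iff V)
    qed
    have "h (gen V v) = (\<Sum>w\<in>Leaf ` ?B. sT (Poly_Mapping.lookup (gen V v) w) (ev w))"
      by (rule h_eq[OF _ keys]) (simp add: phi.vs1.finite_representation)
    also have "\<dots> = (\<Sum>b\<in>?B. phi (scal V (phi.vs1.representation (basis_of V) v b) b))"
      by (subst sum.reindex) (auto simp: inj_on_def V ev_def phi.scale)
    also have "\<dots> = phi v"
      using phi.vs1.sum_nonzero_representation_eq[of "basis_of V" v] basis_of[OF V]
      by (simp add: phi.sum[symmetric])
    finally show ?thesis .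
  qed
  have "Vector_Spaces.linear fscale sT h"
    using add scale phi.vs2.vector_space_axioms
    by (simp add: Vector_Spaces.linear_iff vector_space_fscale)
  then show ?thesis using prod gen by blast
qed

theorem free_algebra_unique:
  fixes V :: "('k::field, 'v::ab_group_add) unital_space"
    and sT :: "'k \<Rightarrow> 't::ab_group_add \<Rightarrow> 't" and mu :: "int \<Rightarrow> 't \<Rightarrow> 't \<Rightarrow> 't"
  assumes V: "vector_space (scal V)"
    and add: "\<And>h x y. h \<in> {h1, h2} \<Longrightarrow> x \<in> free_algebra V \<Longrightarrow> y \<in> free_algebra V \<Longrightarrow>
           h (x + y) = h x + h y"
    and scale: "\<And>h c x. h \<in> {h1, h2} \<Longrightarrow> x \<in> free_algebra V \<Longrightarrow> h (fscale c x) = sT c (h x)"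
    and prod: "\<And>h n x y. h \<in> {h1, h2} \<Longrightarrow> x \<in> free_algebra V \<Longrightarrow> y \<in> free_algebra V \<Longrightarrow>
           h (fprod n x y) = mu n (h x) (h y)"
    and gen: "\<And>v. h1 (gen V v) = h2 (gen V v)"
    and p: "p \<in> free_algebra V"
  shows "h1 p = h2 p"
proof -
  interpret vector_space "scal V" by (fact V)
  have word: "Poly_Mapping.single t 1 \<in> free_algebra V \<and>
      h1 (Poly_Mapping.single t 1) = h2 (Poly_Mapping.single t 1)"
    if "set_word t \<subseteq> basis_of V" for t
    using that
  proof (induction t)
    case (Leaf b)
    then have "representation (basis_of V) b = (\<lambda>v. if v = b then 1 else 0)"
      by (intro representation_basis basis_of V) simp
    then have "Poly_Mapping.single (Leaf b) 1 = gen V b"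
      by (intro poly_mapping_eqI, rename_tac t, case_tac t)
        (auto simp: V lookup_single when_def)
    then show ?case by (simp add: gen gen_in_free_algebra V)
  next
    case (Node n s t)
    have "Poly_Mapping.single (Node n s t) 1 =
        fprod n (Poly_Mapping.single s 1) (Poly_Mapping.single t (1::'k))"
      by (intro poly_mapping_eqI, rename_tac t, case_tac t)
        (auto simp: V lookup_single when_def)
    then show ?case using Node by (simp add: prod free_algebra_closed)
  qed
  have zero: "h 0 = 0" if "h \<in> {h1, h2}" for h
    using add[OF that, of 0 0] by (simp add: free_algebra_closed)
  have "(\<Sum>t\<in>A. Poly_Mapping.single t (Poly_Mapping.lookup p t)) \<in> free_algebra V \<and>
      h1 (\<Sum>t\<in>A. Poly_Mapping.single t (Poly_Mapping.lookup p t)) =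
      h2 (\<Sum>t\<in>A. Poly_Mapping.single t (Poly_Mapping.lookup p t))"
    if "finite A" "A \<subseteq> Poly_Mapping.keys p" for A
    using that
  proof (induction A rule: finite_induct)
    case empty
    then show ?case by (simp add: zero free_algebra_closed)
  next
    case (insert t A)
    have eq: "Poly_Mapping.single t (Poly_Mapping.lookup p t) =
        fscale (Poly_Mapping.lookup p t) (Poly_Mapping.single t 1)"
      by (auto intro!: poly_mapping_eqI simp: lookup_single when_def)
    have "set_word t \<subseteq> basis_of V"
      using insert.prems p by (auto simp: free_algebra_def)
    from word[OF this] insert show ?case
      by (simp add: eq add scale free_algebra_closed)
  qed
  moreover have "(\<Sum>t\<in>Poly_Mapping.keys p. Poly_Mapping.single t (Poly_Mapping.lookup p t)) = p"
    by (rule poly_mapping_eqI) (auto simp: lookup_sum lookup_single when_def in_keys_iff)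
  ultimately show ?thesis
    by (metis finite_keys order_refl)
qed

inductive_set monomials :: "('k::field, 'v::ab_group_add) unital_space \<Rightarrow> ('k, 'v) expr set"
  for V where
  gen: "gen V v \<in> monomials V"
| prod: "x \<in> monomials V \<Longrightarrow> y \<in> monomials V \<Longrightarrow> fprod n x y \<in> monomials V"

text \<open>\<open>homogeneous V i x\<close>: the element \<open>x\<close> of \<open>F(V)\<close> has parity \<open>i\<close>.\<close>

inductive homogeneous ::
    "('k::field, 'v::ab_group_add) unital_space \<Rightarrow> bit \<Rightarrow> ('k, 'v) expr \<Rightarrow> bool"
  for V where
  gen: "v \<in> part V i \<Longrightarrow> homogeneous V i (gen V v)"
| prod: "homogeneous V i x \<Longrightarrow> homogeneous V j y \<Longrightarrow> homogeneous V (i + j) (fprod n x y)"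
| zero: "homogeneous V i 0"
| add: "homogeneous V i x \<Longrightarrow> homogeneous V i y \<Longrightarrow> homogeneous V i (x + y)"
| scale: "homogeneous V i x \<Longrightarrow> homogeneous V i (fscale c x)"


section \<open>The vertex algebra ideal\<close>

definition fone :: "('k::field, 'v::ab_group_add) unital_space \<Rightarrow> ('k, 'v) expr" where
  "fone V = gen V (vac V)"

definition fD :: "('k::field, 'v::ab_group_add) unital_space \<Rightarrow> ('k, 'v) expr \<Rightarrow> ('k, 'v) expr" where
  "fD V x = fprod (- 2) x (fone V)"

definition locality_generators ::
    "('k::field, 'v::ab_group_add) unital_space \<Rightarrow> ('v \<Rightarrow> 'v \<Rightarrow> nat) \<Rightarrow> ('k, 'v) expr set" where
  "locality_generators V N = {fprod n (gen V u) (gen V v) | n u v. n \<ge> int (N u v)}"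

text \<open>The indices \<open>-1\<close> and all sufficiently large integers, with threshold \<open>K\<close>.\<close>

definition index_range :: "int \<Rightarrow> int set" where
  "index_range K = insert (- 1) {K..}"

text \<open>
  \<open>vertex_ideal V N K E\<close> is the ideal of \<open>F(V)\<close> generated by the vertex algebra relations and the
  additional elements \<open>E\<close>.  The infinite sums in the rules \<open>skew\<close> and \<open>borcherds\<close>
  are to be read modulo the ideal that is being generated; this makes the definition inductive:
  such a sum may be cut off at any \<open>M\<close> for which all the factors \<open>y\<^sub>n\<^sub>+\<^sub>kx\<close> (respectively
  \<open>y\<^sub>n\<^sub>+\<^sub>kz\<close> and \<open>x\<^sub>kz\<close>) with \<open>k \<ge> M\<close> already belong to the ideal.  Different admissible
  cut-offs give the same element modulo the ideal.
\<close>

inductive_set vertex_ideal ::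
    "('k::field_char_0, 'v::ab_group_add) unital_space \<Rightarrow> ('v \<Rightarrow> 'v \<Rightarrow> nat) \<Rightarrow> int \<Rightarrow>
     ('k, 'v) expr set \<Rightarrow> ('k, 'v) expr set"
  for V N K E where
  zero: "0 \<in> vertex_ideal V N K E"
| add: "x \<in> vertex_ideal V N K E \<Longrightarrow> y \<in> vertex_ideal V N K E \<Longrightarrow> x + y \<in> vertex_ideal V N K E"
| scale: "x \<in> vertex_ideal V N K E \<Longrightarrow> fscale c x \<in> vertex_ideal V N K E"
| left: "x \<in> vertex_ideal V N K E \<Longrightarrow> y \<in> free_algebra V \<Longrightarrow> fprod n y x \<in> vertex_ideal V N K E"
| right: "x \<in> vertex_ideal V N K E \<Longrightarrow> y \<in> free_algebra V \<Longrightarrow> fprod n x y \<in> vertex_ideal V N K E"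
| extra: "x \<in> E \<Longrightarrow> x \<in> vertex_ideal V N K E"
| vacuum: "homogeneous V i x \<Longrightarrow> n \<in> index_range K \<Longrightarrow>
    fprod n (fone V) x - (if n = - 1 then x else 0) \<in> vertex_ideal V N K E"
| locality: "x \<in> locality_generators V N \<Longrightarrow> x \<in> vertex_ideal V N K E"
| derivation: "homogeneous V i x \<Longrightarrow> homogeneous V j y \<Longrightarrow> n \<in> index_range K \<Longrightarrow>
    fD V (fprod n x y) - fprod n (fD V x) y - fprod n x (fD V y) \<in> vertex_ideal V N K E"
| translation: "homogeneous V i x \<Longrightarrow> homogeneous V j y \<Longrightarrow>
    fprod n (fD V x) y + fscale (of_int n) (fprod (n - 1) x y) \<in> vertex_ideal V N K E"
| skew: "homogeneous V i x \<Longrightarrow> homogeneous V j y \<Longrightarrow> n \<in> index_range K \<Longrightarrow>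
    (\<forall>k\<ge>M. fprod (n + int k) y x \<in> vertex_ideal V N K E) \<Longrightarrow>
    fprod n x y +
      fscale (super_sign i j)
        (\<Sum>k<M. fscale ((- 1) powi (n + int k) / fact k) ((fD V ^^ k) (fprod (n + int k) y x)))
      \<in> vertex_ideal V N K E"
| borcherds: "homogeneous V i x \<Longrightarrow> homogeneous V j y \<Longrightarrow> homogeneous V l z \<Longrightarrow>
    m \<in> index_range K \<Longrightarrow> n \<in> index_range K \<Longrightarrow>
    (\<forall>k\<ge>M. fprod (n + int k) y z \<in> vertex_ideal V N K E \<and>
            fprod (int k) x z \<in> vertex_ideal V N K E) \<Longrightarrow>
    fprod n (fprod m x y) z -
      (\<Sum>k<M. fscale ((of_int m gchoose k) * (- 1) ^ k)
        (fprod (m - int k) x (fprod (n + int k) y z) -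
         fscale ((- 1) powi m * super_sign i j)
           (fprod (m + n - int k) y (fprod (int k) x z))))
      \<in> vertex_ideal V N K E"


section \<open>Souped-up Lie algebras\<close>

record ('k, 'g, 'a) souped_up =
  scalA :: "'k \<Rightarrow> 'a \<Rightarrow> 'a"
  partA :: "bit \<Rightarrow> 'a set"
  multA :: "'a \<Rightarrow> 'a \<Rightarrow> 'a"
  oneA :: 'a
  scalG :: "'k \<Rightarrow> 'g \<Rightarrow> 'g"
  partG :: "bit \<Rightarrow> 'g set"
  bracketG :: "'g \<Rightarrow> 'g \<Rightarrow> 'g"
  smultG :: "'a \<Rightarrow> 'g \<Rightarrow> 'g"  \<comment> \<open>the module action \<open>ag\<close>\<close>
  actA :: "'g \<Rightarrow> 'a \<Rightarrow> 'a"  \<comment> \<open>the action \<open>[g,a]\<close> by derivations\<close>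

locale souped_up_lie_algebra =
  fixes S :: "('k::field_char_0, 'g::ab_group_add, 'a::ab_group_add) souped_up"
  assumes spaceA: "super_vector_space (scalA S) (partA S)"
    and spaceG: "super_vector_space (scalG S) (partG S)"
    and mult_bilinear: "even_bilinear (scalA S) (partA S) (scalA S) (partA S) (scalA S) (partA S) (multA S)"
    and mult_assoc: "multA S (multA S a b) c = multA S a (multA S b c)"
    and mult_commute: "a \<in> partA S i \<Longrightarrow> b \<in> partA S j \<Longrightarrow>
          multA S a b = scalA S (super_sign i j) (multA S b a)"
    and one_even: "oneA S \<in> partA S 0"
    and one_mult: "multA S (oneA S) a = a"
    and one_nonzero: "oneA S \<noteq> 0"
    and bracket_bilinear: "even_bilinear (scalG S) (partG S) (scalG S) (partG S) (scalG S) (partG S) (bracketG S)"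
    and bracket_antisym: "g \<in> partG S i \<Longrightarrow> h \<in> partG S j \<Longrightarrow>
          bracketG S g h = - scalG S (super_sign i j) (bracketG S h g)"
    and jacobi: "f \<in> partG S i \<Longrightarrow> g \<in> partG S j \<Longrightarrow>
          bracketG S f (bracketG S g h) =
            bracketG S (bracketG S f g) h + scalG S (super_sign i j) (bracketG S g (bracketG S f h))"
    and smult_bilinear: "even_bilinear (scalA S) (partA S) (scalG S) (partG S) (scalG S) (partG S) (smultG S)"
    and smult_assoc: "smultG S (multA S a b) g = smultG S a (smultG S b g)"
    and smult_one: "smultG S (oneA S) g = g"
    and act_bilinear: "even_bilinear (scalG S) (partG S) (scalA S) (partA S) (scalA S) (partA S) (actA S)"
    and act_bracket: "g \<in> partG S i \<Longrightarrow> h \<in> partG S j \<Longrightarrow>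
          actA S (bracketG S g h) a =
            actA S g (actA S h a) - scalA S (super_sign i j) (actA S h (actA S g a))"
    and act_derivation: "g \<in> partG S i \<Longrightarrow> a \<in> partA S j \<Longrightarrow>
          actA S g (multA S a b) =
            multA S (actA S g a) b + scalA S (super_sign i j) (multA S a (actA S g b))"
    and bracket_smult: "g \<in> partG S i \<Longrightarrow> a \<in> partA S j \<Longrightarrow>
          bracketG S g (smultG S a h) =
            smultG S (actA S g a) h + scalG S (super_sign i j) (smultG S a (bracketG S g h))"

text \<open>The Lie algebra \<open>\<ss> = \<gg> \<oplus> \<aa>\<close> and its additional structure.\<close>

definition souped_space ::
    "('k, 'g::ab_group_add, 'a::ab_group_add) souped_up \<Rightarrow> ('k, 'g \<times> 'a) unital_space" where
  "souped_space S =
     \<lparr>scal = (\<lambda>c (g, a). (scalG S c g, scalA S c a)),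
      part = (\<lambda>i. partG S i \<times> partA S i),
      vac = (0, oneA S)\<rparr>"

text \<open>
  Here \<open>[a,h] = -(-1)\<^sup>p\<^sup>(\<^sup>a\<^sup>)\<^sup>p\<^sup>(\<^sup>h\<^sup>)[h,a]\<close> for homogeneous \<open>a \<in> \<aa>\<close> and \<open>h \<in> \<gg>\<close>, extended bilinearly.
\<close>

fun souped_bracket ::
    "('k::field, 'g::ab_group_add, 'a::ab_group_add) souped_up \<Rightarrow> 'g \<times> 'a \<Rightarrow> 'g \<times> 'a \<Rightarrow> 'g \<times> 'a" where
  "souped_bracket S (g, a) (h, b) =
     (bracketG S g h,
      actA S g b -
        (\<Sum>i\<in>{0, 1}. \<Sum>j\<in>{0, 1}.
           scalA S (super_sign i j) (actA S (component (partG S) j h) (component (partA S) i a))))"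

fun souped_smult ::
    "('k, 'g, 'a) souped_up \<Rightarrow> 'a \<Rightarrow> 'g \<times> 'a \<Rightarrow> 'g \<times> 'a" where
  "souped_smult S a (h, b) = (smultG S a h, multA S a b)"

definition souped_generators ::
    "('k::field, 'g::ab_group_add, 'a::ab_group_add) souped_up \<Rightarrow> ('k, 'g \<times> 'a) expr set" where
  "souped_generators S =
     {fprod 0 (gen (souped_space S) s) (gen (souped_space S) t)
        - gen (souped_space S) (souped_bracket S s t) | s t. True} \<union>
     {fprod (- 1) (gen (souped_space S) (0, a)) (gen (souped_space S) s)
        - gen (souped_space S) (souped_smult S a s) | a s. True} \<union>
     {fprod (- 1) (gen (souped_space S) (0, multA S a b)) x
        - fprod (- 1) (gen (souped_space S) (0, a)) (fprod (- 1) (gen (souped_space S) (0, b)) x)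
        | a b x. x \<in> monomials (souped_space S)}"

definition souped_ideal ::
    "('k::field_char_0, 'g::ab_group_add, 'a::ab_group_add) souped_up \<Rightarrow>
     ('g \<times> 'a \<Rightarrow> 'g \<times> 'a \<Rightarrow> nat) \<Rightarrow> int \<Rightarrow> ('k, 'g \<times> 'a) expr set" where
  "souped_ideal S N K = vertex_ideal (souped_space S) N K (souped_generators S)"

end

theory Submission
  imports Defs
begin

text \<open>
  Let \<open>x\<close> and \<open>y\<close> be the images of \<open>a\<close> and \<open>g\<close> in \<open>F(\<ss>)\<close>, and suppose that \<open>x\<^sub>ny\<close> lies in the
  ideal for all \<open>n \<ge> 2\<close>.  Put \<open>c = x\<^sub>1y\<close> and compute modulo the ideal, where \<open>x\<^sub>0y = -\<one>\<close> and
  \<open>y\<^sub>0x = \<one>\<close>.  Three consequences of the relations clash.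

  \<^item> Skew symmetry gives \<open>y\<^sub>0x = -x\<^sub>0y + Dc\<close>, because the terms with \<open>x\<^sub>ny\<close>, \<open>n \<ge> 2\<close>, disappear.  Both
    sides being known, \<open>Dc = 0\<close> (\<open>D_first_product_vanishes\<close>).
  \<^item> The Borcherds identity expands \<open>(x\<^sub>-\<^sub>1x)\<^sub>-\<^sub>1y\<close> as \<open>x\<^sub>-\<^sub>1(x\<^sub>-\<^sub>1y) + 2(x\<^sub>-\<^sub>2(x\<^sub>0y) + x\<^sub>-\<^sub>3c)\<close>
    (\<open>square_action\<close>).  The souped-up relations identify \<open>(x\<^sub>-\<^sub>1x)\<^sub>-\<^sub>1y\<close> with \<open>x\<^sub>-\<^sub>1(x\<^sub>-\<^sub>1y)\<close>, so that
    \<open>x\<^sub>-\<^sub>3c = -x\<^sub>-\<^sub>2(x\<^sub>0y) = x\<^sub>-\<^sub>2\<one> = Dx\<close>.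
  \<^item> As \<open>Dc = 0\<close>, derivatives of a product with \<open>c\<close> fall on the left factor only, whence
    \<open>2x\<^sub>-\<^sub>3c = D\<^sup>2w\<close> for \<open>w = x\<^sub>-\<^sub>1c\<close> (\<open>second_derivative_on_left_factor\<close>).

  Therefore \<open>2Dx = D\<^sup>2w\<close>.  By the translation rule \<open>(D\<^sup>2w)\<^sub>1y = -(Dw)\<^sub>0y = 0\<close>, whereas
  \<open>(Dx)\<^sub>1y = -x\<^sub>0y = \<one>\<close>.  So \<open>\<one>\<close> lies in the ideal (\<open>vacuum_in_ideal\<close>), contrary to
  \<open>I(\<ss>) \<inter> \<ss> = {0}\<close>.  Hence \<open>x\<^sub>2y\<close> is omitted, and with it \<open>x\<^sub>1y\<close>, since membership among the locality
  generators passes to larger indices.  The bound \<open>N \<ge> 3\<close> then follows from one example in which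
  \<open>[g,a] = \<one>\<close> occurs: the polynomial vector fields on the line, with \<open>g\<close> the derivation \<open>d/dt\<close> and
  \<open>a\<close> the coordinate \<open>t\<close>.

  Two technical points need care.  Only the translation rule is imposed for all indices, the
  other relations for the index \<open>-1\<close> and for large indices; derivation and skew symmetry at the other
  nonnegative indices are recovered by descending from large indices, replacing \<open>x\<close> by \<open>Dx\<close>.  And \<open>g\<close> may have components of both parities, while the relations
  speak of homogeneous elements.  The products \<open>x\<^sub>ny\<^sub>i\<close> with the components \<open>y\<^sub>i\<close> of \<open>y\<close> lie in the ideal only for
  large \<open>n\<close>, so the sums in the relations are first cut off far out, then added over \<open>i\<close>, and
  shortened only afterwards.
\<close>

section \<open>Products in the free algebra\<close>

lemma fprod_add_left: "fprod n (x + y) z = fprod n x z + fprod n y z"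
  and fprod_fscale_left: "fprod n (fscale c x) z = fscale c (fprod n x z)"
  using linear_fprod_left[of n z] by (auto simp: Vector_Spaces.linear_iff)

lemma fprod_add_right: "fprod n x (y + z) = fprod n x y + fprod n x z"
  and fprod_fscale_right: "fprod n x (fscale c y) = fscale c (fprod n x y)"
  using linear_fprod_right[of n x] by (auto simp: Vector_Spaces.linear_iff)

interpretation expr: vector_space "fscale :: 'k::field \<Rightarrow> ('k, 'v) expr \<Rightarrow> ('k, 'v) expr"
  by (rule vector_space_fscale)

lemma fprod_diff_left: "fprod n (x - y) z = fprod n x z - fprod n y z"
  by (metis add_diff_cancel diff_add_cancel fprod_add_left)

lemma fprod_diff_right: "fprod n x (y - z) = fprod n x y - fprod n x z"
  by (metis add_diff_cancel diff_add_cancel fprod_add_right)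

text \<open>
  Distinct pairs \<open>(u, v)\<close> may give the same locality generator \<open>u\<^sub>nv\<close>.  A nonzero product, however,
  determines its index and, up to mutually inverse scalars, its two factors, so that two such pairs
  give the same generator at every index.
\<close>

lemma fprod_eq_fprod:
  assumes eq: "fprod m x y = fprod n u v" and "x \<noteq> 0" "y \<noteq> 0"
  shows "m = n" "fprod l x y = fprod l u v"
proof -
  obtain s t where "Poly_Mapping.lookup x s \<noteq> 0" "Poly_Mapping.lookup y t \<noteq> 0"
    using assms by (metis poly_mapping_eqI lookup_zero)
  moreover have node: "Poly_Mapping.lookup (fprod m x y) (Node m s t)
      = Poly_Mapping.lookup (fprod n u v) (Node m s t)" for s t
    using eq by simp
  ultimately show "m = n"
    by (metis lookup_fprod_Node mult_eq_0_iff)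
  show "fprod l x y = fprod l u v"
  proof (rule poly_mapping_eqI)
    fix w show "Poly_Mapping.lookup (fprod l x y) w = Poly_Mapping.lookup (fprod l u v) w"
      using node \<open>m = n\<close> by (cases w) auto
  qed
qed

lemma locality_generators_upward:
  assumes "fprod m x y \<in> locality_generators V N" "m \<le> n" "x \<noteq> 0" "y \<noteq> 0"
  shows "fprod n x y \<in> locality_generators V N"
proof -
  obtain m' u v where "fprod m x y = fprod m' (gen V u) (gen V v)" "m' \<ge> int (N u v)"
    using assms(1) by (auto simp: locality_generators_def)
  moreover from fprod_eq_fprod[OF this(1) assms(3,4)]
  have "m = m'" "fprod n x y = fprod n (gen V u) (gen V v)" by blast+
  moreover have "int (N u v) \<le> n"
    using calculation assms(2) by simp
  ultimately show ?thesis
    unfolding locality_generators_def by blast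
qed

section \<open>Calculations modulo the ideal\<close>

text \<open>
  The form of induction by which an identity imposed for large indices is extended to all
  nonnegative ones.
\<close>

lemma downward_from_large:
  assumes large: "\<And>n. K \<le> n \<Longrightarrow> P n"
    and step: "\<And>n. 0 \<le> n \<Longrightarrow> P (n + 1) \<Longrightarrow> P n" and "0 \<le> (n::int)"
  shows "P n"
  using \<open>0 \<le> n\<close>
proof (induction "nat (K - n)" arbitrary: n)
  case 0
  then show ?case by (intro large) simp
next
  case (Suc p)
  have "P (n + 1)" using Suc.prems Suc.hyps(2) by (intro Suc.hyps(1)) auto
  then show ?case by (rule step[OF Suc.prems])
qed

locale vertex_relations =
  fixes V :: "('k::field_char_0, 'v::ab_group_add) unital_space"
    and N :: "'v \<Rightarrow> 'v \<Rightarrow> nat" and K :: int and E :: "('k, 'v) expr set"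
  assumes vs: "vector_space (scal V)" and vac_even: "vac V \<in> part V 0"
begin

abbreviation "J \<equiv> vertex_ideal V N K E"
abbreviation "D \<equiv> fD V"

definition cong :: "('k, 'v) expr \<Rightarrow> ('k, 'v) expr \<Rightarrow> bool" (infix "\<approx>" 50)
  where "x \<approx> y \<longleftrightarrow> x - y \<in> J"

lemma fone_free: "fone V \<in> free_algebra V"
  by (simp add: fone_def gen_in_free_algebra vs)

lemma homogeneous_free: "homogeneous V i x \<Longrightarrow> x \<in> free_algebra V"
  by (induction rule: homogeneous.induct) (simp_all add: gen_in_free_algebra vs free_algebra_closed)

lemma J_diff: "x \<in> J \<Longrightarrow> y \<in> J \<Longrightarrow> x - y \<in> J"
  using vertex_ideal.add[of x V N K E "fscale (- 1) y"] vertex_ideal.scale[of y V N K E "- 1"]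
  by simp

lemma J_minus: "x \<in> J \<Longrightarrow> - x \<in> J"
  using J_diff[OF vertex_ideal.zero] by fastforce

lemma J_sum: "(\<And>k. k \<in> B \<Longrightarrow> f k \<in> J) \<Longrightarrow> sum f B \<in> J"
  by (induction B rule: infinite_finite_induct) (auto intro: vertex_ideal.zero vertex_ideal.add)

lemma cong_zero: "x \<approx> 0 \<longleftrightarrow> x \<in> J"
  by (simp add: cong_def)

lemma cong_refl: "x \<approx> x"
  by (simp add: cong_def vertex_ideal.zero)

lemma cong_sym: "x \<approx> y \<Longrightarrow> y \<approx> x"
  unfolding cong_def using J_diff[OF vertex_ideal.zero, of "x - y"] by simp

lemma cong_trans [trans]: "x \<approx> y \<Longrightarrow> y \<approx> z \<Longrightarrow> x \<approx> z"
  unfolding cong_def using vertex_ideal.add[of "x - y" V N K E "y - z"] by simp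

lemma cong_add: "x \<approx> y \<Longrightarrow> u \<approx> v \<Longrightarrow> x + u \<approx> y + v"
  unfolding cong_def using vertex_ideal.add[of "x - y" V N K E "u - v"] by (simp add: algebra_simps)

lemma cong_diff: "x \<approx> y \<Longrightarrow> u \<approx> v \<Longrightarrow> x - u \<approx> y - v"
  unfolding cong_def using J_diff[of "x - y" "u - v"] by (simp add: algebra_simps)

lemma cong_scale: "x \<approx> y \<Longrightarrow> fscale c x \<approx> fscale c y"
  unfolding cong_def using vertex_ideal.scale[of "x - y" V N K E c]
  by (simp add: expr.scale_right_diff_distrib)

lemma cong_scale_cancel: "fscale c x \<approx> fscale c y \<Longrightarrow> c \<noteq> 0 \<Longrightarrow> x \<approx> y"
  using cong_scale[of "fscale c x" "fscale c y" "inverse c"] by simp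

lemma cong_sum: "(\<And>k. k \<in> B \<Longrightarrow> f k \<approx> g k) \<Longrightarrow> sum f B \<approx> sum g B"
  unfolding cong_def by (simp flip: sum_subtractf add: J_sum)

lemma cong_left: "x \<approx> y \<Longrightarrow> z \<in> free_algebra V \<Longrightarrow> fprod n z x \<approx> fprod n z y"
  unfolding cong_def using vertex_ideal.left[of "x - y" V N K E z n] by (simp add: fprod_diff_right)

lemma cong_right: "x \<approx> y \<Longrightarrow> z \<in> free_algebra V \<Longrightarrow> fprod n x z \<approx> fprod n y z"
  unfolding cong_def using vertex_ideal.right[of "x - y" V N K E z n] by (simp add: fprod_diff_left)

lemma cong_D: "x \<approx> y \<Longrightarrow> D x \<approx> D y"
  unfolding fD_def by (rule cong_right[OF _ fone_free])

lemma D_add: "D (x + y) = D x + D y" and D_scale: "D (fscale c x) = fscale c (D x)"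
  by (simp_all add: fD_def fprod_add_left fprod_fscale_left)

lemma Dpow_add: "(D ^^ k) (x + y) = (D ^^ k) x + (D ^^ k) y"
  and Dpow_scale: "(D ^^ k) (fscale c x) = fscale c ((D ^^ k) x)"
  by (induction k) (simp_all add: D_add D_scale)

lemma cong_Dpow: "x \<approx> y \<Longrightarrow> (D ^^ k) x \<approx> (D ^^ k) y"
  by (induction k) (simp_all add: cong_D)

lemma Dpow_J: "x \<in> J \<Longrightarrow> (D ^^ k) x \<in> J"
  using cong_Dpow[of x 0 k] Dpow_scale[of k 0 0] by (simp add: cong_zero)

lemma homogeneous_D: "homogeneous V i x \<Longrightarrow> homogeneous V i (D x)"
  using homogeneous.prod[OF _ homogeneous.gen[OF vac_even], of i x "- 2"]
  by (simp only: fD_def fone_def add_0_right)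

lemma translation:
  "homogeneous V i x \<Longrightarrow> homogeneous V j y \<Longrightarrow> fprod n (D x) y \<approx> fscale (- of_int n) (fprod (n - 1) x y)"
  using vertex_ideal.translation[of V i x j y n N K E] by (simp add: cong_def expr.scale_minus_left)

text \<open>
  Applied to \<open>Dx\<close>, the identity at \<open>n + 1\<close> becomes by translation \<open>-(n + 1)\<close> times the identity for
  \<open>x\<close> at \<open>n\<close>; the factor is invertible for \<open>n \<ge> 0\<close>.
\<close>

lemma derivation_nonneg:
  assumes "homogeneous V i x" "homogeneous V j y" "0 \<le> n"
  shows "D (fprod n x y) \<approx> fprod n (D x) y + fprod n x (D y)"
proof -
  have "\<forall>x. homogeneous V i x \<longrightarrow> D (fprod n x y) \<approx> fprod n (D x) y + fprod n x (D y)"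
  proof (rule downward_from_large[where K = K, OF _ _ \<open>0 \<le> n\<close>])
    fix n assume "K \<le> n"
    then show "\<forall>x. homogeneous V i x \<longrightarrow> D (fprod n x y) \<approx> fprod n (D x) y + fprod n x (D y)"
      using vertex_ideal.derivation[OF _ assms(2), of i _ n K N E]
      by (auto simp: cong_def index_range_def algebra_simps)
  next
    fix n :: int
    assume n: "0 \<le> n"
      and IH: "\<forall>x. homogeneous V i x \<longrightarrow>
        D (fprod (n + 1) x y) \<approx> fprod (n + 1) (D x) y + fprod (n + 1) x (D y)"
    show "\<forall>x. homogeneous V i x \<longrightarrow> D (fprod n x y) \<approx> fprod n (D x) y + fprod n x (D y)"
    proof (intro allI impI)
      fix x assume x: "homogeneous V i x"
      let ?c = "- of_int (n + 1) :: 'k"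
      have tr: "fprod (n + 1) (D u) v \<approx> fscale ?c (fprod n u v)"
        if "homogeneous V i u" "homogeneous V j v" for u v
        using translation[OF that, of "n + 1"] by simp
      have "fscale ?c (D (fprod n x y)) = D (fscale ?c (fprod n x y))"
        by (simp add: D_scale)
      also have "\<dots> \<approx> D (fprod (n + 1) (D x) y)"
        by (rule cong_sym[OF cong_D[OF tr[OF x assms(2)]]])
      also have "\<dots> \<approx> fprod (n + 1) (D (D x)) y + fprod (n + 1) (D x) (D y)"
        using IH homogeneous_D[OF x] by blast
      also have "\<dots> \<approx> fscale ?c (fprod n (D x) y) + fscale ?c (fprod n x (D y))"
        by (intro cong_add tr x homogeneous_D assms)
      also have "\<dots> = fscale ?c (fprod n (D x) y + fprod n x (D y))"
        by (simp add: expr.scale_right_distrib)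
      finally have *: "fscale ?c (D (fprod n x y)) \<approx> fscale ?c (fprod n (D x) y + fprod n x (D y))" .
      have "?c = of_int (- (n + 1))" by simp
      then have "?c \<noteq> 0" using n by (simp only: of_int_eq_0_iff)
      with * show "D (fprod n x y) \<approx> fprod n (D x) y + fprod n x (D y)"
        by (rule cong_scale_cancel)
    qed
  qed
  with assms(1) show ?thesis by blast
qed

section \<open>Skew symmetry at all nonnegative indices\<close>

definition skew_coeff :: "int \<Rightarrow> nat \<Rightarrow> 'k" where
  "skew_coeff n k = (- 1) powi (n + int k) / fact k"

lemma skew_coeff_Suc: "of_nat (Suc k) * skew_coeff n (Suc k) = - skew_coeff n k"
proof -
  have "(- 1 :: 'k) powi (n + int (Suc k)) = - ((- 1) powi (n + int k))"
    using power_int_add[of "- 1 :: 'k" "n + int k" 1] by (simp add: algebra_simps)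
  then show ?thesis by (simp add: skew_coeff_def del: of_nat_Suc)
qed

lemma skew_coeff_plus1: "skew_coeff (n + 1) k = - skew_coeff n k"
  using power_int_add[of "- 1 :: 'k" "n + int k" 1] by (simp add: skew_coeff_def algebra_simps)

text \<open>
  In the descent from \<open>n + 1\<close> to \<open>n\<close>, each derivative of a product \<open>y\<^sub>n\<^sub>+\<^sub>1\<^sub>+\<^sub>k(Dx)\<close> yields a multiple
  of \<open>B (k + 1)\<close> and a multiple of \<open>B k\<close>, where \<open>B k = D\<^sup>k(y\<^sub>n\<^sub>+\<^sub>kx)\<close>.  This sum collects the parts that
  cancel against each other; only the boundary term survives.
\<close>

lemma skew_telescope:
  "(\<Sum>k<M. fscale (skew_coeff n k) (B (Suc k)) + fscale (of_nat k * skew_coeff n k) (B k))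
    = fscale (- (of_nat M * skew_coeff n M)) (B M)"
proof (induction M)
  case (Suc M)
  then show ?case
    by (simp only: sum.lessThan_Suc skew_coeff_Suc) (simp add: expr.scale_minus_left)
qed simp

text \<open>
  The same descent as for the derivation rule.  The cut-off \<open>M\<close> can be kept fixed: the products of
  \<open>y\<close> with \<open>Dx\<close> from index \<open>n + 1 + M\<close> on involve products of \<open>y\<close> with \<open>x\<close> from index \<open>n + M\<close> on.
\<close>

lemma skew_nonneg:
  assumes "homogeneous V i x" "homogeneous V j y" "0 \<le> n"
    and "\<And>k. M \<le> k \<Longrightarrow> fprod (n + int k) y x \<in> J"
  shows "fprod n x y \<approx> fscale (- super_sign i j)
    (\<Sum>k<M. fscale (skew_coeff n k) ((D ^^ k) (fprod (n + int k) y x)))"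
proof -
  let ?s = "super_sign i j :: 'k"
  define T where "T n x = (\<Sum>k<M. fscale (skew_coeff n k) ((D ^^ k) (fprod (n + int k) y x)))" for n x
  define P where "P n \<longleftrightarrow> (\<forall>x. homogeneous V i x \<longrightarrow> (\<forall>k\<ge>M. fprod (n + int k) y x \<in> J) \<longrightarrow>
    fprod n x y \<approx> fscale (- ?s) (T n x))" for n
  have "P n"
  proof (rule downward_from_large[where K = "max 0 K", OF _ _ \<open>0 \<le> n\<close>])
    fix n assume "max 0 K \<le> n"
    then show "P n"
      using vertex_ideal.skew[OF _ assms(2), of i _ n K M N E]
      by (auto simp: cong_def index_range_def T_def P_def skew_coeff_def expr.scale_minus_left)
  next
    fix n :: int
    assume n: "0 \<le> n" and IH: "P (n + 1)"
    show "P n"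
      unfolding P_def
    proof (intro allI impI)
      fix x assume x: "homogeneous V i x" and loc: "\<forall>k\<ge>M. fprod (n + int k) y x \<in> J"
      let ?n1 = "of_int (n + 1) :: 'k"
      define B where "B k = (D ^^ k) (fprod (n + int k) y x)" for k
      have yDx: "fprod (n + 1 + int k) y (D x) \<approx>
          D (fprod (n + int (Suc k)) y x) + fscale (?n1 + of_nat k) (fprod (n + int k) y x)" for k
      proof -
        let ?m = "n + 1 + int k"
        have "fprod ?m y (D x) = fprod ?m (D y) x + fprod ?m y (D x) - fprod ?m (D y) x"
          by simp
        also have "\<dots> \<approx> D (fprod ?m y x) - fscale (- of_int ?m) (fprod (?m - 1) y x)"
          by (rule cong_diff[OF cong_sym[OF derivation_nonneg] translation])
            (use n x assms in auto)
        finally show ?thesis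
          by (simp add: expr.scale_minus_left algebra_simps)
      qed
      have J0: "B M \<in> J"
        using loc by (simp add: B_def Dpow_J)
      have "\<forall>k\<ge>M. fprod (n + 1 + int k) y (D x) \<in> J"
      proof (intro allI impI)
        fix k assume "M \<le> k"
        then have "fprod (n + int (Suc k)) y x \<in> J" "fprod (n + int k) y x \<in> J"
          using loc le_Suc_eq by blast+
        then have "D (fprod (n + int (Suc k)) y x) + fscale (?n1 + of_nat k) (fprod (n + int k) y x) \<approx> 0"
          using Dpow_J[of _ 1] by (simp add: cong_zero vertex_ideal.add vertex_ideal.scale)
        from cong_trans[OF yDx this] show "fprod (n + 1 + int k) y (D x) \<in> J"
          by (simp add: cong_zero)
      qed
      with IH have skew: "fprod (n + 1) (D x) y \<approx> fscale (- ?s) (T (n + 1) (D x))"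
        using homogeneous_D[OF x] by (simp add: P_def)
      have "T (n + 1) (D x) \<approx> (\<Sum>k<M. fscale (skew_coeff (n + 1) k) ((D ^^ k)
          (D (fprod (n + int (Suc k)) y x) + fscale (?n1 + of_nat k) (fprod (n + int k) y x))))"
        unfolding T_def by (intro cong_sum cong_scale cong_Dpow yDx)
      also have "\<dots> = (\<Sum>k<M. fscale (skew_coeff (n + 1) k) (B (Suc k))
            + fscale (of_nat k * skew_coeff (n + 1) k) (B k)
            - fscale ?n1 (fscale (skew_coeff n k) (B k)))"
        by (intro sum.cong refl)
          (simp only: skew_coeff_plus1, simp add: Dpow_add Dpow_scale B_def funpow_swap1 expr.scale_right_distrib
            expr.scale_left_distrib expr.scale_minus_left algebra_simps)
      also have "\<dots> = fscale (- (of_nat M * skew_coeff (n + 1) M)) (B M) - fscale ?n1 (T n x)"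
        by (simp only: sum_subtractf skew_telescope) (simp add: T_def B_def expr.scale_sum_right)
      also have "\<dots> \<approx> 0 - fscale ?n1 (T n x)"
        by (intro cong_diff cong_refl) (simp add: cong_zero vertex_ideal.scale J_minus J0)
      also have "0 - fscale ?n1 (T n x) = fscale (- ?n1) (T n x)"
        by (simp only: expr.scale_minus_left diff_0)
      finally have T: "T (n + 1) (D x) \<approx> fscale (- ?n1) (T n x)" .
      have "fscale (- ?n1) (fprod n x y) \<approx> fprod (n + 1) (D x) y"
        using cong_sym[OF translation[OF x assms(2), of "n + 1"]] by simp
      also note skew
      also have "fscale (- ?s) (T (n + 1) (D x)) \<approx> fscale (- ?s) (fscale (- ?n1) (T n x))"
        by (rule cong_scale[OF T])
      also have "\<dots> = fscale (- ?n1) (fscale (- ?s) (T n x))"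
        by (simp add: mult.commute)
      finally have *: "fscale (- ?n1) (fprod n x y) \<approx> fscale (- ?n1) (fscale (- ?s) (T n x))" .
      have "- ?n1 = of_int (- (n + 1))" by simp
      then have "- ?n1 \<noteq> 0" using n by (simp only: of_int_eq_0_iff)
      with * show "fprod n x y \<approx> fscale (- ?s) (T n x)"
        by (rule cong_scale_cancel)
    qed
  qed
  with assms(1,4) show ?thesis by (simp add: P_def T_def)
qed

section \<open>Elements of mixed parity\<close>

text \<open>
  Translation and derivation involve no cut-off, so by bilinearity they hold for sums of
  homogeneous elements of different parities.
\<close>

definition graded :: "('k, 'v) expr \<Rightarrow> bool" where
  "graded x \<longleftrightarrow> (\<exists>x0 x1. homogeneous V 0 x0 \<and> homogeneous V 1 x1 \<and> x = x0 + x1)"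

lemma gradedE:
  assumes "graded x"
  obtains h where "\<And>i. homogeneous V i (h i)" "x = h 0 + h 1"
proof -
  obtain x0 x1 where "homogeneous V 0 x0" "homogeneous V 1 x1" "x = x0 + x1"
    using assms by (auto simp: graded_def)
  moreover from this have "homogeneous V i (if i = 0 then x0 else x1)" for i
    by (cases i) auto
  ultimately show thesis
    by (intro that[of "\<lambda>i. if i = 0 then x0 else x1"]) auto
qed

lemma homogeneous_graded: "homogeneous V i x \<Longrightarrow> graded x"
proof (cases "i = 0")
  case True
  moreover assume "homogeneous V i x"
  ultimately show ?thesis
    unfolding graded_def by (intro exI[of _ x] exI[of _ 0]) (simp add: homogeneous.zero)
next
  case False
  moreover assume "homogeneous V i x"
  ultimately show ?thesis
    unfolding graded_def by (intro exI[of _ 0] exI[of _ x]) (simp add: homogeneous.zero)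
qed

lemma graded_free: "graded x \<Longrightarrow> x \<in> free_algebra V"
  unfolding graded_def using homogeneous_free free_algebra_closed(2) by blast

lemma graded_add: "graded x \<Longrightarrow> graded y \<Longrightarrow> graded (x + y)"
proof -
  assume "graded x" "graded y"
  then obtain f h where "\<And>i. homogeneous V i (f i)" "x = f 0 + f 1"
    "\<And>i. homogeneous V i (h i)" "y = h 0 + h 1"
    by (metis gradedE)
  then show ?thesis
    unfolding graded_def
    by (intro exI[of _ "f 0 + h 0"] exI[of _ "f 1 + h 1"]) (auto intro: homogeneous.add)
qed

lemma graded_fprod: "graded x \<Longrightarrow> graded y \<Longrightarrow> graded (fprod n x y)"
proof -
  assume "graded x" "graded y"
  then obtain f h where "\<And>i. homogeneous V i (f i)" "x = f 0 + f 1"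
    "\<And>i. homogeneous V i (h i)" "y = h 0 + h 1"
    by (metis gradedE)
  then show ?thesis
    by (auto simp: fprod_add_left fprod_add_right
        intro!: graded_add homogeneous_graded[OF homogeneous.prod])
qed

lemma graded_D: "graded x \<Longrightarrow> graded (D x)"
  unfolding fD_def fone_def
  by (rule graded_fprod[OF _ homogeneous_graded[OF homogeneous.gen[OF vac_even]]])

lemma translation_graded:
  assumes "graded x" "graded y"
  shows "fprod n (D x) y \<approx> fscale (- of_int n) (fprod (n - 1) x y)"
proof -
  obtain f h where f: "\<And>i. homogeneous V i (f i)" "x = f 0 + f 1"
    and h: "\<And>i. homogeneous V i (h i)" "y = h 0 + h 1"
    by (metis gradedE assms)
  have "fprod n (D (f 0)) (h 0) + fprod n (D (f 0)) (h 1) + (fprod n (D (f 1)) (h 0) + fprod n (D (f 1)) (h 1))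
    \<approx> fscale (- of_int n) (fprod (n - 1) (f 0) (h 0)) + fscale (- of_int n) (fprod (n - 1) (f 0) (h 1)) +
      (fscale (- of_int n) (fprod (n - 1) (f 1) (h 0)) + fscale (- of_int n) (fprod (n - 1) (f 1) (h 1)))"
    by (intro cong_add translation) (rule f h)+
  then show ?thesis
    by (simp add: f(2) h(2) D_add fprod_add_left fprod_add_right expr.scale_right_distrib algebra_simps)
qed

lemma derivation_graded:
  assumes "graded x" "graded y"
  shows "D (fprod (- 1) x y) \<approx> fprod (- 1) (D x) y + fprod (- 1) x (D y)"
proof -
  obtain f h where f: "\<And>i. homogeneous V i (f i)" "x = f 0 + f 1"
    and h: "\<And>i. homogeneous V i (h i)" "y = h 0 + h 1"
    by (metis gradedE assms)
  have *: "D (fprod (- 1) u v) \<approx> fprod (- 1) (D u) v + fprod (- 1) u (D v)"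
    if "homogeneous V i u" "homogeneous V j v" for i j u v
    using vertex_ideal.derivation[OF that, of "- 1" K N E]
    by (simp add: cong_def index_range_def algebra_simps)
  have "D (fprod (- 1) (f 0) (h 0)) + D (fprod (- 1) (f 0) (h 1)) +
      (D (fprod (- 1) (f 1) (h 0)) + D (fprod (- 1) (f 1) (h 1)))
    \<approx> (fprod (- 1) (D (f 0)) (h 0) + fprod (- 1) (f 0) (D (h 0))) +
      (fprod (- 1) (D (f 0)) (h 1) + fprod (- 1) (f 0) (D (h 1))) +
      ((fprod (- 1) (D (f 1)) (h 0) + fprod (- 1) (f 1) (D (h 0))) +
      (fprod (- 1) (D (f 1)) (h 1) + fprod (- 1) (f 1) (D (h 1))))"
    by (intro cong_add *) (rule f h)+
  then show ?thesis
    by (simp add: f(2) h(2) D_add fprod_add_left fprod_add_right algebra_simps)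
qed


section \<open>The vacuum in the ideal\<close>

lemma second_derivative_on_left_factor:
  assumes x: "graded x" and "graded c" "D c \<in> J"
  shows "D (D (fprod (- 1) x c)) \<approx> fscale 2 (fprod (- 3) x c)"
proof -
  have step: "D (fprod (- 1) u c) \<approx> fprod (- 1) (D u) c" if "graded u" for u
  proof -
    have "fprod (- 1) u (D c) \<approx> 0"
      using assms(3) graded_free[OF that] by (simp add: cong_zero vertex_ideal.left)
    from cong_trans[OF derivation_graded[OF that assms(2)] cong_add[OF cong_refl this]]
    show ?thesis by simp
  qed
  have "D (D (fprod (- 1) x c)) \<approx> D (fprod (- 1) (D x) c)"
    by (intro cong_D step x)
  also have "\<dots> \<approx> fprod (- 1) (D (D x)) c"
    by (intro step graded_D x)
  also have "\<dots> \<approx> fprod (- 2) (D x) c"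
    using translation_graded[OF graded_D[OF x] assms(2), of "- 1"] by simp
  also have "\<dots> \<approx> fscale 2 (fprod (- 3) x c)"
    using translation_graded[OF x assms(2), of "- 2"] by simp
  finally show ?thesis .
qed

text \<open>
  Skew symmetry at the index \<open>0\<close>.  The sums for the two components \<open>h i\<close> of \<open>y\<close> share a cut-off; only
  in their total, which involves \<open>y\<close> itself, do the terms of index at least \<open>2\<close> vanish.
\<close>

lemma D_first_product_vanishes:
  assumes "homogeneous V 0 x" "\<And>i. homogeneous V i (h i)" "y = h 0 + h 1"
    and loc: "\<And>i n. int M \<le> n \<Longrightarrow> fprod n x (h i) \<in> J"
    and two: "\<And>n. 2 \<le> n \<Longrightarrow> fprod n x y \<in> J"
    and sk: "fprod 0 y x \<approx> - fprod 0 x y"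
  shows "D (fprod 1 x y) \<in> J"
proof -
  \<comment> \<open>far enough out for both components, with room to split off the terms \<open>k = 0\<close> and \<open>k = 1\<close>\<close>
  let ?M = "M + 2"
  define f where "f z k = fscale (skew_coeff 0 k) ((D ^^ k) (fprod (int k) x z))" for z k
  have hom: "fprod 0 (h i) x \<approx> fscale (- 1) (\<Sum>k<?M. f (h i) k)" for i
    using skew_nonneg[OF assms(2) assms(1) order_refl, of ?M i] loc
    by (simp add: super_sign_def f_def)
  have f_add: "f (h 0) k + f (h 1) k = f y k" for k
    by (simp add: f_def assms(3) fprod_add_right Dpow_add expr.scale_right_distrib)
  have "(\<Sum>k<?M. f y k) = f y 0 + f y 1 + (\<Sum>k<M. f y (k + 2))"
    using sum.lessThan_Suc_shift[of "f y" "Suc M"] sum.lessThan_Suc_shift[of "\<lambda>k. f y (Suc k)" M]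
    by (simp del: sum.lessThan_Suc add: algebra_simps)
  moreover have "(\<Sum>k<M. f y (k + 2)) \<in> J"
    unfolding f_def using two by (intro J_sum vertex_ideal.scale Dpow_J) simp
  moreover have "f y 0 = fprod 0 x y" "f y 1 = - D (fprod 1 x y)"
    by (simp_all add: f_def skew_coeff_def)
  ultimately have sum: "(\<Sum>k<?M. f y k) \<approx> fprod 0 x y - D (fprod 1 x y)"
    by (simp add: cong_def)
  have "- fprod 0 x y \<approx> fprod 0 y x"
    by (rule cong_sym[OF sk])
  also have "\<dots> = fprod 0 (h 0) x + fprod 0 (h 1) x"
    by (simp add: assms(3) fprod_add_left)
  also have "\<dots> \<approx> fscale (- 1) (\<Sum>k<?M. f (h 0) k) + fscale (- 1) (\<Sum>k<?M. f (h 1) k)"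
    by (intro cong_add hom)
  also have "\<dots> = fscale (- 1) (\<Sum>k<?M. f y k)"
    by (simp only: expr.scale_right_distrib[symmetric] sum.distrib[symmetric] f_add)
  also have "\<dots> \<approx> fscale (- 1) (fprod 0 x y - D (fprod 1 x y))"
    by (rule cong_scale[OF sum])
  finally show ?thesis
    using vertex_ideal.scale[of "- D (fprod 1 x y)" V N K E "- 1"] by (simp add: cong_def)
qed

text \<open>
  The Borcherds identity with both indices \<open>-1\<close>: all binomial coefficients become \<open>1\<close>, and each of
  \<open>x\<^sub>-\<^sub>2(x\<^sub>0y)\<close> and \<open>x\<^sub>-\<^sub>3(x\<^sub>1y)\<close> arises once from either half of the sum.
\<close>

lemma square_action:
  assumes "homogeneous V 0 x" "\<And>i. homogeneous V i (h i)" "y = h 0 + h 1"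
    and loc: "\<And>i n. int M \<le> n \<Longrightarrow> fprod n x (h i) \<in> J"
    and two: "\<And>n. 2 \<le> n \<Longrightarrow> fprod n x y \<in> J"
  shows "fprod (- 1) (fprod (- 1) x x) y \<approx> fprod (- 1) x (fprod (- 1) x y) +
    fscale 2 (fprod (- 2) x (fprod 0 x y) + fprod (- 3) x (fprod 1 x y))"
proof -
  \<comment> \<open>the terms \<open>k = 0, 1, 2\<close> contain the products \<open>x\<^sub>ny\<close> with \<open>n < 2\<close>\<close>
  let ?M = "M + 3"
  define f where "f z k = fprod (- 1 - int k) x (fprod (int k - 1) x z)
    + fprod (- 2 - int k) x (fprod (int k) x z)" for z k
  have coeff: "((- 1 :: 'k) gchoose k) * (- 1) ^ k = 1" for k
  proof -
    have "(- 1 :: 'k) gchoose k = (- 1) ^ k * (of_nat k gchoose k)"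
      using gbinomial_minus[of "1 :: 'k" k] by simp
    then show ?thesis by (simp flip: binomial_gbinomial power_mult_distrib)
  qed
  have hom: "fprod (- 1) (fprod (- 1) x x) (h i) \<approx> (\<Sum>k<?M. f (h i) k)" for i
  proof -
    have "\<forall>k\<ge>?M. fprod (- 1 + int k) x (h i) \<in> J \<and> fprod (int k) x (h i) \<in> J"
      using loc by simp
    from vertex_ideal.borcherds[OF assms(1,1) assms(2) _ _ this, of "- 1"] show ?thesis
      by (simp add: cong_def index_range_def super_sign_def coeff f_def expr.scale_minus_left
          algebra_simps)
  qed
  have f_add: "f (h 0) k + f (h 1) k = f y k" for k
    by (simp add: f_def assms(3) fprod_add_right)
  have "(\<Sum>k<?M. f y k) = f y 0 + f y 1 + f y 2 + (\<Sum>k<M. f y (k + 3))"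
    using sum.lessThan_Suc_shift[of "f y" "Suc (Suc M)"]
      sum.lessThan_Suc_shift[of "\<lambda>k. f y (Suc k)" "Suc M"]
      sum.lessThan_Suc_shift[of "\<lambda>k. f y (Suc (Suc k))" M]
    by (simp del: sum.lessThan_Suc add: algebra_simps numeral_2_eq_2 numeral_3_eq_3)
  moreover have "(\<Sum>k<M. f y (k + 3)) \<in> J"
    unfolding f_def using homogeneous_free[OF assms(1)]
    by (auto intro!: J_sum vertex_ideal.add vertex_ideal.left[OF two])
  moreover have "fprod (- 4) x (fprod 2 x y) \<in> J"
    using two homogeneous_free[OF assms(1)] by (simp add: vertex_ideal.left)
  moreover have "f y 0 + f y 1 + f y 2 = fprod (- 1) x (fprod (- 1) x y) +
    fscale 2 (fprod (- 2) x (fprod 0 x y) + fprod (- 3) x (fprod 1 x y)) + fprod (- 4) x (fprod 2 x y)"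
    by (simp add: f_def expr.scale_left_distrib[of 1 1, simplified] algebra_simps)
  ultimately have sum: "(\<Sum>k<?M. f y k) \<approx> fprod (- 1) x (fprod (- 1) x y) +
    fscale 2 (fprod (- 2) x (fprod 0 x y) + fprod (- 3) x (fprod 1 x y))"
    by (simp add: cong_def vertex_ideal.add)
  have "fprod (- 1) (fprod (- 1) x x) y = fprod (- 1) (fprod (- 1) x x) (h 0) + fprod (- 1) (fprod (- 1) x x) (h 1)"
    by (simp add: assms(3) fprod_add_right)
  also have "\<dots> \<approx> (\<Sum>k<?M. f (h 0) k) + (\<Sum>k<?M. f (h 1) k)"
    by (intro cong_add hom)
  also have "\<dots> = (\<Sum>k<?M. f y k)"
    by (simp only: sum.distrib[symmetric] f_add)
  also note sum
  finally show ?thesis .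
qed

text \<open>
  The contradiction in its general form: in any vertex algebra in which \<open>x\<close> and \<open>y\<close> behave like a
  coordinate function and a vector field dual to it, with \<open>x\<^sub>ny = 0\<close> for \<open>n \<ge> 2\<close>, and in which
  \<open>x\<^sub>-\<^sub>1x\<close> acts on \<open>y\<close> as the square of \<open>x\<close> does, the vacuum vanishes.
\<close>

theorem vacuum_in_ideal:
  assumes x: "homogeneous V 0 x" and h: "\<And>i. homogeneous V i (h i)" and y: "y = h 0 + h 1"
    and loc: "\<And>i n. int M \<le> n \<Longrightarrow> fprod n x (h i) \<in> J"
    and two: "\<And>n. 2 \<le> n \<Longrightarrow> fprod n x y \<in> J"
    and xy: "fprod 0 x y \<approx> - fone V" and yx: "fprod 0 y x \<approx> fone V"
    and square: "fprod (- 1) (fprod (- 1) x x) y \<approx> fprod (- 1) x (fprod (- 1) x y)"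
  shows "fone V \<in> J"
proof -
  define c where "c = fprod 1 x y"
  define w where "w = fprod (- 1) x c"
  have gx: "graded x" and gy: "graded y" and xF: "x \<in> free_algebra V"
    using x h by (auto simp: y intro: graded_add homogeneous_graded homogeneous_free)
  then have gc: "graded c" and gw: "graded w"
    by (simp_all add: c_def w_def graded_fprod)
  have minus: "u \<approx> v \<Longrightarrow> - u \<approx> - v" for u v
    using cong_scale[of u v "- 1"] by simp
  have "fone V \<approx> - fprod 0 x y"
    using cong_sym[OF minus[OF xy]] by simp
  then have skew: "fprod 0 y x \<approx> - fprod 0 x y"
    by (rule cong_trans[OF yx])
  have Dc: "D c \<in> J"
    unfolding c_def by (rule D_first_product_vanishes[OF x h y loc two skew])
  have "fscale 2 (fprod (- 2) x (fprod 0 x y) + fprod (- 3) x c) \<approx> fscale 2 0"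
    using cong_sym[OF cong_diff[OF square_action[OF x h y loc two] square]]
    by (simp add: c_def)
  then have "fprod (- 2) x (fprod 0 x y) + fprod (- 3) x c \<approx> 0"
    by (rule cong_scale_cancel) simp
  moreover have "fprod (- 2) x (fprod 0 x y) \<approx> - D x"
    using cong_left[OF xy xF, of "- 2"] fprod_fscale_right[of "- 2" x "- 1" "fone V"]
    by (simp add: fD_def)
  ultimately have "D x \<approx> fprod (- 3) x c"
    using cong_sym[OF cong_diff] by fastforce
  then have "fscale 2 (D x) \<approx> D (D w)"
    using cong_trans[OF cong_scale cong_sym[OF second_derivative_on_left_factor[OF gx gc Dc]]]
    by (simp add: w_def)
  then have "fprod 1 (fscale 2 (D x)) y \<approx> fprod 1 (D (D w)) y"
    by (rule cong_right[OF _ graded_free[OF gy]])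
  also have "\<dots> \<approx> fscale (- 1) (fprod 0 (D w) y)"
    using translation_graded[OF graded_D[OF gw] gy, of 1] by simp
  also have "\<dots> \<approx> fscale (- 1) 0"
    using translation_graded[OF gw gy, of 0] by (intro cong_scale) simp
  also have "\<dots> = fscale 2 0"
    by simp
  finally have "fprod 1 (D x) y \<approx> 0"
    unfolding fprod_fscale_left by (rule cong_scale_cancel) simp
  note \<open>fone V \<approx> - fprod 0 x y\<close>
  also have "- fprod 0 x y \<approx> fprod 1 (D x) y"
    using cong_sym[OF translation_graded[OF gx gy, of 1]] by simp
  also note \<open>fprod 1 (D x) y \<approx> 0\<close>
  finally have "fone V \<approx> 0" .
  then show ?thesis by (simp add: cong_zero)
qed

end

section \<open>Souped-up Lie algebras\<close>

lemma super_vector_space_decompose: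
  assumes "super_vector_space sc P"
  obtains h where "\<And>i. h i \<in> P i" "x = h 0 + h 1"
proof -
  obtain y where "y \<in> P 0" "x - y \<in> P 1"
    using assms unfolding super_vector_space_def by blast
  moreover from this have "(if i = 0 then y else x - y) \<in> P i" for i
    by (cases i) auto
  ultimately show thesis
    by (intro that[of "\<lambda>i. if i = 0 then y else x - y"]) auto
qed

lemma component_eq:
  assumes "super_vector_space sc P" "y \<in> P i" "x - y \<in> P (i + 1)"
  shows "component P i x = y"
  unfolding component_def
proof (rule the_equality)
  fix z assume z: "z \<in> P i \<and> x - z \<in> P (i + 1)"
  have uniq: "\<exists>!y. y \<in> P 0 \<and> x - y \<in> P 1" for x
    using assms(1) by (auto simp: super_vector_space_def)
  show "z = y"
  proof (cases i)
    case zero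
    then show ?thesis using z assms(2,3) uniq by auto
  next
    case one
    then have "x - z \<in> P 0 \<and> x - (x - z) \<in> P 1" "x - y \<in> P 0 \<and> x - (x - y) \<in> P 1"
      using z assms(2,3) by auto
    then have "x - z = x - y"
      using uniq[of x] by blast
    then show ?thesis by simp
  qed
qed (use assms in auto)

lemma zero_in_part: "super_vector_space sc P \<Longrightarrow> 0 \<in> P i"
  unfolding super_vector_space_def using module.subspace_0 module_iff_vector_space by blast

lemma linear_zero: "Vector_Spaces.linear s t f \<Longrightarrow> f 0 = 0"
  unfolding Vector_Spaces.linear_iff by (metis add_cancel_right_right)

lemma souped_generatorsI:
  "fprod 0 (gen (souped_space S) s) (gen (souped_space S) t)
    - gen (souped_space S) (souped_bracket S s t) \<in> souped_generators S"
  "fprod (- 1) (gen (souped_space S) (0, a)) (gen (souped_space S) s)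
    - gen (souped_space S) (souped_smult S a s) \<in> souped_generators S"
  "x \<in> monomials (souped_space S) \<Longrightarrow>
    fprod (- 1) (gen (souped_space S) (0, multA S a b)) x
    - fprod (- 1) (gen (souped_space S) (0, a)) (fprod (- 1) (gen (souped_space S) (0, b)) x)
      \<in> souped_generators S"
  unfolding souped_generators_def by blast+

context souped_up_lie_algebra
begin

abbreviation "W \<equiv> souped_space S"

lemma vector_spaces: "vector_space (scalA S)" "vector_space (scalG S)"
  using spaceA spaceG by (auto simp: super_vector_space_def)

lemma vector_space_souped: "vector_space (scal W)"
proof -
  interpret A: vector_space "scalA S" by (rule vector_spaces)
  interpret G: vector_space "scalG S" by (rule vector_spaces)
  show ?thesis
    by unfold_locales
      (auto simp: souped_space_def A.scale_right_distrib G.scale_right_distrib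
        A.scale_left_distrib G.scale_left_distrib)
qed

lemma vacuum_even: "vac W \<in> part W 0"
  using one_even zero_in_part[OF spaceG] by (simp add: souped_space_def)

lemma bilinear_zero:
  "actA S 0 a = 0" "actA S g 0 = 0" "bracketG S 0 g = 0" "bracketG S g 0 = 0"
  using act_bilinear bracket_bilinear
  by (fastforce simp: even_bilinear_def dest: linear_zero)+

lemma gen_eq_0: "gen W v = 0 \<longleftrightarrow> v = 0"
proof -
  interpret gen: Vector_Spaces.linear "scal W" fscale "gen W"
    by (rule linear_gen[OF vector_space_souped])
  show ?thesis
    using inj_gen[OF vector_space_souped] gen.zero by (metis injD)
qed

lemma gen_nonzero:
  assumes "actA S g a = oneA S"
  shows "gen W (0, a) \<noteq> 0" "gen W (g, 0) \<noteq> 0"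
  using assms one_nonzero bilinear_zero by (auto simp: gen_eq_0 zero_prod_def)

lemma act_add: "actA S (g + h) a = actA S g a + actA S h a"
  using act_bilinear by (auto simp: even_bilinear_def Vector_Spaces.linear_iff)

lemma bracket_function_field:
  assumes "a \<in> partA S 0"
  shows "souped_bracket S (0, a) (g, 0) = (0, - actA S g a)"
    and "souped_bracket S (g, 0) (0, a) = (0, actA S g a)"
proof -
  interpret A: vector_space "scalA S" by (rule vector_spaces)
  have A0: "component (partA S) 0 a = a" "component (partA S) 1 a = 0"
    using assms zero_in_part[OF spaceA] by (auto intro!: component_eq[OF spaceA])
  have zero: "component (partG S) i 0 = 0" "component (partA S) i 0 = 0" for i
    using zero_in_part[OF spaceA] zero_in_part[OF spaceG]
    by (auto intro!: component_eq[OF spaceA] component_eq[OF spaceG])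
  obtain h where h: "\<And>i. h i \<in> partG S i" "g = h 0 + h 1"
    using super_vector_space_decompose[OF spaceG] by metis
  then have "component (partG S) i g = h i" for i
    by (cases i) (auto intro!: component_eq[OF spaceG] simp: h(2))
  then show "souped_bracket S (0, a) (g, 0) = (0, - actA S g a)"
    by (simp add: A0 zero bilinear_zero super_sign_def h(2) act_add)
  show "souped_bracket S (g, 0) (0, a) = (0, actA S g a)"
    by (simp add: A0 zero bilinear_zero super_sign_def)
qed

text \<open>
  A locality generator \<open>a\<^sub>2g\<close> would put all \<open>a\<^sub>ng\<close> with \<open>n \<ge> 2\<close> into the ideal, and the souped-up
  relations supply the remaining conditions under which the vacuum is in the ideal.
\<close>

theorem second_product_not_local:
  assumes trivial: "souped_ideal S N K \<inter> range (gen W) = {0}"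
    and a: "a \<in> partA S 0" and ga: "actA S g a = oneA S"
  shows "fprod 2 (gen W (0, a)) (gen W (g, 0)) \<notin> locality_generators W N"
proof
  let ?x = "gen W (0, a)" and ?y = "gen W (g, 0)"
  assume local2: "fprod 2 ?x ?y \<in> locality_generators W N"
  interpret vertex_relations W N K "souped_generators S"
    by (simp add: vertex_relations_def vector_space_souped vacuum_even)
  interpret gen: Vector_Spaces.linear "scal W" fscale "gen W"
    by (rule linear_gen[OF vector_space_souped])
  obtain h where h: "\<And>i. h i \<in> partG S i" "g = h 0 + h 1"
    using super_vector_space_decompose[OF spaceG] by metis
  define H where "H i = gen W (h i, 0)" for i
  have one: "gen W (0, oneA S) = fone W"
    by (simp add: fone_def souped_space_def)
  have neg: "gen W (0, - oneA S) = - fone W"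
    using gen.neg[of "(0, oneA S)"] by (simp add: one)
  have "fone W \<in> J"
  proof (rule vacuum_in_ideal)
    show "homogeneous W 0 ?x"
      using a zero_in_part[OF spaceG] by (intro homogeneous.gen) (simp add: souped_space_def)
    show "homogeneous W i (H i)" for i
      unfolding H_def
      using h(1) zero_in_part[OF spaceA] by (intro homogeneous.gen) (simp add: souped_space_def)
    show "?y = H 0 + H 1"
      by (simp add: H_def h(2) flip: gen.add)
    let ?M = "max (N (0, a) (h 0, 0)) (N (0, a) (h 1, 0))"
    show "fprod n ?x (H i) \<in> J" if "int ?M \<le> n" for i n
      unfolding H_def using that
      by (intro vertex_ideal.locality, unfold locality_generators_def, cases i)
        (simp_all, (metis max.bounded_iff of_nat_max)+)
    show "fprod n ?x ?y \<in> J" if "2 \<le> n" for n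
      using that by (intro vertex_ideal.locality locality_generators_upward[OF local2] gen_nonzero[OF ga])
    have "cong (fprod 0 ?x ?y) (gen W (souped_bracket S (0, a) (g, 0)))"
      unfolding cong_def by (rule vertex_ideal.extra[OF souped_generatorsI(1)])
    then show "cong (fprod 0 ?x ?y) (- fone W)"
      by (simp only: bracket_function_field[OF a] ga neg)
    have "cong (fprod 0 ?y ?x) (gen W (souped_bracket S (g, 0) (0, a)))"
      unfolding cong_def by (rule vertex_ideal.extra[OF souped_generatorsI(1)])
    then show "cong (fprod 0 ?y ?x) (fone W)"
      by (simp only: bracket_function_field[OF a] ga one)
    have "cong (fprod (- 1) ?x ?x) (gen W (souped_smult S a (0, a)))"
      unfolding cong_def by (rule vertex_ideal.extra[OF souped_generatorsI(2)])
    also have "souped_smult S a (0, a) = (0, multA S a a)"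
      using smult_bilinear by (auto simp: even_bilinear_def dest: linear_zero)
    finally have "cong (fprod (- 1) (fprod (- 1) ?x ?x) ?y) (fprod (- 1) (gen W (0, multA S a a)) ?y)"
      by (rule cong_right[OF _ gen_in_free_algebra[OF vector_space_souped]])
    also have "cong \<dots> (fprod (- 1) ?x (fprod (- 1) ?x ?y))"
      unfolding cong_def
      by (rule vertex_ideal.extra[OF souped_generatorsI(3)[OF monomials.gen]])
    finally show "cong (fprod (- 1) (fprod (- 1) ?x ?x) ?y) (fprod (- 1) ?x (fprod (- 1) ?x ?y))" .
  qed
  then have "fone W = 0"
    using trivial by (auto simp: souped_ideal_def fone_def)
  then show False
    using one_nonzero by (simp add: gen_eq_0 zero_prod_def flip: one)
qed

theorem two_omitted:
  assumes "souped_ideal S N K \<inter> range (gen W) = {0}"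
    and "a \<in> partA S 0" and ga: "actA S g a = oneA S"
  shows "2 \<le> card {n::int. n > 0 \<and>
    fprod n (gen W (0, a)) (gen W (g, 0)) \<notin> locality_generators W N}" (is "2 \<le> card ?O")
proof -
  let ?x = "gen W (0, a)" and ?y = "gen W (g, 0)"
  have "fprod 1 ?x ?y \<notin> locality_generators W N"
    using second_product_not_local[OF assms] gen_nonzero[OF ga]
      locality_generators_upward[of 1 ?x ?y W N 2] by auto
  then have "{1, 2} \<subseteq> ?O"
    using second_product_not_local[OF assms] by auto
  \<comment> \<open>finiteness matters, since an infinite set would have cardinality \<open>0\<close>\<close>
  moreover have "?O \<subseteq> {0..<int (N (0, a) (g, 0))}"
  proof
    fix n assume "n \<in> ?O"
    then have "0 < n" "\<not> int (N (0, a) (g, 0)) \<le> n"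
      unfolding locality_generators_def by blast+
    then show "n \<in> {0..<int (N (0, a) (g, 0))}" by simp
  qed
  then have "finite ?O"
    using finite_subset by blast
  ultimately show ?thesis
    using card_mono[of ?O "{1, 2}"] by simp
qed

end

section \<open>Polynomial vector fields on the line\<close>

text \<open>
  A polynomial \<open>f\<close> in the Lie algebra stands for the vector field \<open>f d/dt\<close>; everything is even.
\<close>

definition witt_algebra :: "('k::field_char_0, 'k poly, 'k poly) souped_up" where
  "witt_algebra =
     \<lparr>scalA = smult, partA = (\<lambda>i. if i = 0 then UNIV else {0}), multA = (*), oneA = 1,
      scalG = smult, partG = (\<lambda>i. if i = 0 then UNIV else {0}),
      bracketG = (\<lambda>f g. f * pderiv g - g * pderiv f), smultG = (*),
      actA = (\<lambda>f a. f * pderiv a)\<rparr>"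

lemma witt_algebra: "souped_up_lie_algebra (witt_algebra :: ('k::field_char_0, 'k poly, 'k poly) souped_up)"
proof -
  have vs: "vector_space (smult :: 'k \<Rightarrow> _)"
    by unfold_locales (auto simp: smult_add_right smult_add_left)
  let ?P = "\<lambda>i :: bit. if i = 0 then UNIV else {0 :: 'k poly}"
  have space: "super_vector_space smult ?P"
    unfolding super_vector_space_def
    by (auto simp: vs module.subspace_def module_iff_vector_space)
  have bilinear: "even_bilinear smult ?P smult ?P smult ?P f"
    if "\<And>x y z. f (x + y) z = f x z + f y z" "\<And>c x z. f (smult c x) z = smult c (f x z)"
      "\<And>x y z. f z (x + y) = f z x + f z y" "\<And>c x z. f z (smult c x) = smult c (f z x)"
    for f
  proof -
    have "f 0 z = 0" "f z 0 = 0" for z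
      using that(2)[of 0 0 z] that(4)[of z 0 0] by simp_all
    then show ?thesis
      by (auto simp: even_bilinear_def Vector_Spaces.linear_iff vs that)
  qed
  show ?thesis
    by unfold_locales
      (auto simp: witt_algebra_def space super_sign_def pderiv_mult pderiv_add pderiv_diff pderiv_smult
        smult_add_right smult_diff_right algebra_simps intro!: bilinear split: if_splits)
qed

theorem proposition4p9:
  fixes S :: "('k::field_char_0, 'g::ab_group_add, 'a::ab_group_add) souped_up"
    and N :: "'g \<times> 'a \<Rightarrow> 'g \<times> 'a \<Rightarrow> nat"
    and K :: int
  shows
    "(souped_up_lie_algebra S \<and>
      souped_ideal S N K \<inter> range (gen (souped_space S)) = {0} \<longrightarrow>
        (\<forall>a g. a \<in> partA S 0 \<and> actA S g a = oneA S \<longrightarrow>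
           2 \<le> card {n::int. n > 0 \<and>
             fprod n (gen (souped_space S) (0, a)) (gen (souped_space S) (g, 0))
               \<notin> locality_generators (souped_space S) N}))
     \<and>
     (\<forall>N0::nat.
        (\<forall>T :: ('k, 'k poly, 'k poly) souped_up. souped_up_lie_algebra T \<longrightarrow>
           souped_ideal T (\<lambda>s t. N0) K \<inter> range (gen (souped_space T)) = {0})
        \<longrightarrow> N0 \<ge> 3)"
proof (intro conjI allI impI)
  fix a g
  assume "souped_up_lie_algebra S \<and> souped_ideal S N K \<inter> range (gen (souped_space S)) = {0}"
    and "a \<in> partA S 0 \<and> actA S g a = oneA S"
  then show "2 \<le> card {n::int. n > 0 \<and>
      fprod n (gen (souped_space S) (0, a)) (gen (souped_space S) (g, 0))
        \<notin> locality_generators (souped_space S) N}"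
    by (intro souped_up_lie_algebra.two_omitted[of S N K a g]) auto
next
  fix N0 :: nat
  assume all: "\<forall>T :: ('k, 'k poly, 'k poly) souped_up. souped_up_lie_algebra T \<longrightarrow>
    souped_ideal T (\<lambda>s t. N0) K \<inter> range (gen (souped_space T)) = {0}"
  let ?T = "witt_algebra :: ('k, 'k poly, 'k poly) souped_up"
  have "[:0, 1:] \<in> partA ?T 0" "actA ?T 1 [:0, 1:] = oneA ?T"
    by (simp_all add: witt_algebra_def pderiv_pCons)
  from souped_up_lie_algebra.second_product_not_local[OF witt_algebra _ this] all witt_algebra
  have "fprod 2 (gen (souped_space ?T) (0, [:0, 1:])) (gen (souped_space ?T) (1, 0))
      \<notin> locality_generators (souped_space ?T) (\<lambda>s t. N0)"
    by blast
  then have "\<not> int N0 \<le> 2"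
    unfolding locality_generators_def by blast
  then show "3 \<le> N0" by simp
qed

end
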